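(* Suppose that $g:\mathbb{N}\to\mathbb{N}$ is such that $g(0)=2$ and for each $i\in\mathbb{N}$ either $g(i+1)=g(i)$ or $g(i+1)=pg(i)-p+1$, and suppose that the set $\{i\mid g(i)=g(i+1)\}$ is infinite. Then there is a descending subnormal $p$-chain $\{H_i\}_{i\ge0}$ of subgroups of $\mathcal{L}_1$ such that $H_0=\mathcal{L}_1$, $d(H_i)=g(i)$ for all $i\ge 0$, and $\bigcap_iH_i=\{1\}$.
   Context: $p$ is a fixed prime and $\mathbb{N}$ contains $0$. $\mathcal{L}_1=(\mathbb{Z}/p\mathbb{Z})\wr\mathbb{Z}=\left(\bigoplus_{\mathbb{Z}}\mathbb{Z}/p\mathbb{Z}\right)\rtimes\mathbb{Z}$, where the generator of $\mathbb{Z}$ acts by the shift by one. $d(H)$ is the minimal number of generators of $H$. A descending chain $\{H_i\}$ is a $p$-chain if $[H_i:H_{i+1}]=p$ for all $i$, and it is subnormal if $H_{i+1}$ is normal in $H_i$ for all $i$. *)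

theory Defs
  imports "HOL-Algebra.Algebra" "HOL-Library.Extended_Nat"
begin

definition semidirect_product ::
    "('h \<Rightarrow> 'n \<Rightarrow> 'n) \<Rightarrow> ('n, 'a) monoid_scheme \<Rightarrow> ('h, 'b) monoid_scheme \<Rightarrow> ('n \<times> 'h) monoid"
  where "semidirect_product \<phi> N H =
    \<lparr>carrier = carrier N \<times> carrier H,
     monoid.mult = (\<lambda>(a, h) (b, k). (a \<otimes>\<^bsub>N\<^esub> \<phi> h b, h \<otimes>\<^bsub>H\<^esub> k)),
     one = (\<one>\<^bsub>N\<^esub>, \<one>\<^bsub>H\<^esub>)\<rparr>"

text \<open>The integer \<open>k\<close> moves the lamp at position \<open>i\<close> to position \<open>i + k\<close>.\<close>

definition shift :: "int \<Rightarrow> (int \<Rightarrow> 'a) \<Rightarrow> int \<Rightarrow> 'a"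
  where "shift k f = (\<lambda>i. f (i - k))"

definition lamp_group :: "nat \<Rightarrow> (int \<Rightarrow> int) monoid"
  where "lamp_group p = sum_group (UNIV :: int set) (\<lambda>_. integer_mod_group p)"

definition lamplighter_group :: "nat \<Rightarrow> ((int \<Rightarrow> int) \<times> int) monoid"
  where "lamplighter_group p = semidirect_product shift (lamp_group p) integer_group"

text \<open>The value is \<open>\<infinity>\<close> exactly if the group is not finitely generated (infimum of the empty set).\<close>

definition min_gens :: "('a, 'b) monoid_scheme \<Rightarrow> enat"
  where "min_gens G =
    (INF S \<in> {S. S \<subseteq> carrier G \<and> finite S \<and> generate G S = carrier G}. enat (card S))"

definition subgroup_index :: "('a, 'b) monoid_scheme \<Rightarrow> 'a set \<Rightarrow> nat"
  where "subgroup_index G H = card (rcosets\<^bsub>G\<^esub> H)"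

definition descending_chain :: "('a, 'b) monoid_scheme \<Rightarrow> (nat \<Rightarrow> 'a set) \<Rightarrow> bool"
  where "descending_chain G H \<longleftrightarrow>
    (\<forall>i. subgroup (H i) G) \<and> (\<forall>i. H (Suc i) \<subseteq> H i)"

text \<open>Here \<open>p\<close> is meant to be positive: an infinite index has \<open>card\<close> equal to \<open>0\<close>.\<close>

definition p_chain :: "nat \<Rightarrow> ('a, 'b) monoid_scheme \<Rightarrow> (nat \<Rightarrow> 'a set) \<Rightarrow> bool"
  where "p_chain p G H \<longleftrightarrow> descending_chain G H \<and>
    (\<forall>i. subgroup_index (G\<lparr>carrier := H i\<rparr>) (H (Suc i)) = p)"

definition subnormal_chain :: "('a, 'b) monoid_scheme \<Rightarrow> (nat \<Rightarrow> 'a set) \<Rightarrow> bool"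
  where "subnormal_chain G H \<longleftrightarrow> descending_chain G H \<and>
    (\<forall>i. H (Suc i) \<lhd> G\<lparr>carrier := H i\<rparr>)"

lemma group_semidirect_product:
  assumes N: "group N" and H: "group H"
    and hom: "\<And>h. h \<in> carrier H \<Longrightarrow> \<phi> h \<in> hom N N"
    and one: "\<And>a. a \<in> carrier N \<Longrightarrow> \<phi> \<one>\<^bsub>H\<^esub> a = a"
    and mult: "\<And>h k a. h \<in> carrier H \<Longrightarrow> k \<in> carrier H \<Longrightarrow> a \<in> carrier N
       \<Longrightarrow> \<phi> (h \<otimes>\<^bsub>H\<^esub> k) a = \<phi> h (\<phi> k a)"
  shows "group (semidirect_product \<phi> N H)"
proof -
  interpret N: group N by fact
  interpret H: group H by fact
  have cl: "\<phi> h a \<in> carrier N" if "h \<in> carrier H" "a \<in> carrier N" for h a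
    using hom[OF that(1)] that(2) by (auto simp: hom_def)
  have hm: "\<phi> h (a \<otimes>\<^bsub>N\<^esub> b) = \<phi> h a \<otimes>\<^bsub>N\<^esub> \<phi> h b"
    if "h \<in> carrier H" "a \<in> carrier N" "b \<in> carrier N" for h a b
    using hom[OF that(1)] that(2,3) by (auto simp: hom_def)
  show ?thesis
  proof (rule groupI)
    fix x assume "x \<in> carrier (semidirect_product \<phi> N H)"
    then obtain a h where x: "x = (a, h)" "a \<in> carrier N" "h \<in> carrier H"
      by (auto simp: semidirect_product_def)
    have "\<phi> (inv\<^bsub>H\<^esub> h) (inv\<^bsub>N\<^esub> a) \<otimes>\<^bsub>N\<^esub> \<phi> (inv\<^bsub>H\<^esub> h) a = \<one>\<^bsub>N\<^esub>"
    proof -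
      have "\<phi> (inv\<^bsub>H\<^esub> h) \<one>\<^bsub>N\<^esub> = \<one>\<^bsub>N\<^esub>"
        using hom_one[OF hom N N] x by simp
      then show ?thesis
        using hm[of "inv\<^bsub>H\<^esub> h" "inv\<^bsub>N\<^esub> a" a] x by simp
    qed
    then show "\<exists>y\<in>carrier (semidirect_product \<phi> N H).
        y \<otimes>\<^bsub>semidirect_product \<phi> N H\<^esub> x = \<one>\<^bsub>semidirect_product \<phi> N H\<^esub>"
      using x by (intro bexI[of _ "(\<phi> (inv\<^bsub>H\<^esub> h) (inv\<^bsub>N\<^esub> a), inv\<^bsub>H\<^esub> h)"])
        (auto simp: semidirect_product_def cl)
  qed (auto simp: semidirect_product_def cl hm one mult N.m_assoc H.m_assoc)
qed

lemma carrier_lamp_group: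
  "carrier (lamp_group p) =
    {f. (\<forall>i. f i \<in> carrier (integer_mod_group p)) \<and> finite {i. f i \<noteq> 0}}"
  by (auto simp: lamp_group_def carrier_sum_group PiE_def extensional_def)

lemma group_lamplighter_group: "group (lamplighter_group p)"
  unfolding lamplighter_group_def
proof (rule group_semidirect_product)
  fix k
  show "shift k \<in> hom (lamp_group p) (lamp_group p)"
  proof (rule homI)
    fix f assume f: "f \<in> carrier (lamp_group p)"
    have "{i. f (i - k) \<noteq> 0} = (\<lambda>i. i + k) ` {i. f i \<noteq> 0}"
      by (auto simp: image_iff) (metis diff_add_cancel)
    then show "shift k f \<in> carrier (lamp_group p)"
      using f by (simp add: carrier_lamp_group shift_def)
  qed (simp add: lamp_group_def shift_def restrict_UNIV)
qed (auto simp: lamp_group_def shift_def algebra_simps)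

end

theory Submission
  imports Defs "HOL-Computational_Algebra.Formal_Power_Series"
begin

text \<open>
  Writing \<open>A = \<bbbF>\<^sub>p[t, t\<^sup>-\<^sup>1]\<close> for the lamps, substitute \<open>t = 1 + X\<close> and regard \<open>A\<close> as a subring
  of the power series in \<open>X\<close> over \<open>\<bbbF>\<^sub>p\<close>. For a power series \<open>u\<close> and \<open>n = p\<^sup>a\<close> let \<open>H(n, j)\<close> consist of
  the \<open>(w, k)\<close> with \<open>n\<close> dividing \<open>k\<close> and \<open>w \<equiv> u (t\<^sup>k - 1)\<close> modulo \<open>X\<^sup>j\<close>. Both \<open>H(n, j + 1)\<close> and
  \<open>H(pn, j)\<close> are normal of index \<open>p\<close> in \<open>H(n, j)\<close>. Since \<open>(X\<^sup>j)\<close> is generated by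
  \<open>X\<^sup>j t\<^sup>b\<close>, \<open>0 \<le> b < n\<close>, as a module over \<open>\<bbbF>\<^sub>p[t\<^sup>n, t\<^sup>-\<^sup>n]\<close>, the group \<open>H(n, j)\<close> has \<open>n + 1\<close>
  generators; as \<open>t\<^sup>n - 1 = X\<^sup>n\<close>, it maps onto \<open>(\<int>/p)\<^sup>n\<^sup>+\<^sup>1\<close>, so fewer do not suffice. A step with
  \<open>g(i + 1) = g(i)\<close> increases \<open>j\<close>, the other steps multiply \<open>n = g(i) - 1\<close> by \<open>p\<close>. Since \<open>j\<close> is
  unbounded, \<open>(w, k)\<close> in the intersection satisfies \<open>w = u (t\<^sup>k - 1)\<close>; choosing \<open>u\<close> not rational
  forces \<open>k = 0\<close> and \<open>w = 0\<close>, even if \<open>n\<close> is eventually constant.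
\<close>

section \<open>Power series of lamp configurations\<close>

text \<open>Powers of t = 1 + X. The alternating series is the inverse of 1 + X, so negative
  exponents also give integer coefficients.\<close>

definition tpow :: "int \<Rightarrow> int fps"
  where "tpow k = (if 0 \<le> k then (1 + fps_X) ^ nat k else Abs_fps (\<lambda>i. (-1) ^ i) ^ nat (- k))"

lemma tpow_0 [simp]: "tpow 0 = 1"
  by (simp add: tpow_def)

lemma tpow_1: "tpow 1 = 1 + fps_X"
  by (simp add: tpow_def)

lemma tpow_of_nat: "tpow (int k) = (1 + fps_X) ^ k"
  by (simp add: tpow_def)

lemma tpow_minus_of_nat: "tpow (- int k) = Abs_fps (\<lambda>i. (-1) ^ i) ^ k"
  by (cases k) (simp_all add: tpow_def del: of_nat_Suc)

lemma one_plus_X_mult_alternating: "(1 + fps_X) * Abs_fps (\<lambda>i. (-1) ^ i) = (1 :: int fps)"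
proof (rule fps_ext)
  fix n
  show "fps_nth ((1 + fps_X) * Abs_fps (\<lambda>i. (-1) ^ i)) n = fps_nth (1 :: int fps) n"
    by (cases n) (simp_all add: distrib_right)
qed

lemma tpow_plus_1: "tpow (k + 1) = tpow k * (1 + fps_X)"
proof (cases "0 \<le> k")
  case True
  then show ?thesis
    by (simp add: tpow_def nat_add_distrib mult.commute)
next
  case False
  then obtain m where k: "k = - int (Suc m)"
    by (metis add.commute int_cases linorder_not_le nonneg_int_cases of_nat_Suc of_nat_0_le_iff)
  have "tpow (k + 1) = Abs_fps (\<lambda>i. (-1) ^ i) ^ m"
    using tpow_minus_of_nat[of m] by (simp add: k)
  moreover have "tpow k = Abs_fps (\<lambda>i. (-1) ^ i) ^ m * Abs_fps (\<lambda>i. (-1) ^ i)"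
    using tpow_minus_of_nat[of "Suc m"] by (simp add: k mult.commute)
  ultimately show ?thesis
    using one_plus_X_mult_alternating by (simp add: mult.assoc mult.commute)
qed

lemma tpow_add: "tpow (k + l) = tpow k * tpow l"
proof (induction l rule: int_induct[where k = 0])
  case base
  show ?case by simp
next
  case (step1 i)
  then show ?case
    by (metis add.assoc mult.assoc tpow_plus_1)
next
  case (step2 i)
  have cancel: "tpow (j - 1) = tpow j * Abs_fps (\<lambda>i. (-1) ^ i)" for j
    using tpow_plus_1[of "j - 1"] one_plus_X_mult_alternating by (simp add: mult.assoc)
  show ?case
    using step2 cancel[of i] cancel[of "k + i"] by (simp add: mult.assoc add_diff_eq)
qed

lemma tpow_minus_cancel: "tpow (- k) * tpow k = 1"
  by (simp flip: tpow_add)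

lemma fps_nth_0_tpow [simp]: "fps_nth (tpow k) 0 = 1"
  by (simp add: tpow_def fps_nth_power_0)

lemma fps_nth_one_plus_X_power: "fps_nth ((1 + fps_X) ^ n :: int fps) i = int (n choose i)"
proof (induction n arbitrary: i)
  case (Suc n)
  then show ?case
    by (cases i) (simp_all add: distrib_right)
qed auto

text \<open>The Laurent polynomial in t with coefficients \<open>w\<close>, expanded in X. Entries
  stay integers; reduction modulo p is left to the ideals below.\<close>

definition lamp_series :: "(int \<Rightarrow> int) \<Rightarrow> int fps"
  where "lamp_series w = (\<Sum>i | w i \<noteq> 0. of_int (w i) * tpow i)"

lemma lamp_series_eq_sum:
  assumes "finite A" "{i. w i \<noteq> 0} \<subseteq> A"
  shows "lamp_series w = (\<Sum>i\<in>A. of_int (w i) * tpow i)"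
  unfolding lamp_series_def using assms by (intro sum.mono_neutral_left) auto

lemma lamp_series_zero [simp]: "lamp_series (\<lambda>_. 0) = 0"
  by (simp add: lamp_series_def)

lemma lamp_series_single [simp]: "lamp_series (\<lambda>i. if i = k then c else 0) = of_int c * tpow k"
  by (subst lamp_series_eq_sum[of "{k}"]) auto

lemma
  assumes "finite {i. v i \<noteq> 0}" "finite {i. w i \<noteq> 0}"
  shows lamp_series_add: "lamp_series (\<lambda>i. v i + w i) = lamp_series v + lamp_series w"
    and lamp_series_diff: "lamp_series (\<lambda>i. v i - w i) = lamp_series v - lamp_series w"
proof -
  let ?A = "{i. v i \<noteq> 0} \<union> {i. w i \<noteq> 0}"
  have A: "finite ?A" using assms by simp
  show "lamp_series (\<lambda>i. v i + w i) = lamp_series v + lamp_series w"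
    by (subst (1 2 3) lamp_series_eq_sum[OF A]) (auto simp: distrib_right sum.distrib)
  show "lamp_series (\<lambda>i. v i - w i) = lamp_series v - lamp_series w"
    by (subst (1 2 3) lamp_series_eq_sum[OF A]) (auto simp: left_diff_distrib sum_subtractf)
qed

lemma support_shift: "{i. shift k w i \<noteq> 0} = (\<lambda>i. i + k) ` {i. w i \<noteq> 0}"
  by (auto simp: shift_def image_iff) (metis diff_add_cancel)

lemma shift_shift [simp]: "shift k (shift l w) = shift (k + l) w"
  by (simp add: shift_def algebra_simps)

lemma lamp_series_shift: "lamp_series (shift k w) = tpow k * lamp_series w"
proof -
  have "lamp_series (shift k w) = (\<Sum>i | w i \<noteq> 0. of_int (w i) * tpow (i + k))"
    unfolding lamp_series_def support_shift
    by (subst sum.reindex) (auto simp: shift_def)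
  then show ?thesis
    by (simp add: lamp_series_def tpow_add sum_distrib_left mult_ac)
qed

section \<open>Ideals (p, X^j) of integer power series\<close>

locale prime_modulus =
  fixes p :: nat
  assumes prime: "Factorial_Ring.prime p"
begin

lemma p_gt_1: "1 < p"
  using prime by (rule prime_gt_1_nat)

lemma p_pos: "0 < p"
  using p_gt_1 by simp

text \<open>Series over \<open>\<bbbF>\<^sub>p\<close> are represented by integer series modulo \<open>p\<close>, so that the ideal
  \<open>(X\<^sup>j)\<close> becomes \<open>(p, X\<^sup>j)\<close>.\<close>

definition fps_ideal :: "nat \<Rightarrow> int fps set"
  where "fps_ideal j = {q. \<forall>i<j. int p dvd fps_nth q i}"

lemma fps_ideal_add: "q \<in> fps_ideal j \<Longrightarrow> r \<in> fps_ideal j \<Longrightarrow> q + r \<in> fps_ideal j"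
  and fps_ideal_diff: "q \<in> fps_ideal j \<Longrightarrow> r \<in> fps_ideal j \<Longrightarrow> q - r \<in> fps_ideal j"
  by (auto simp: fps_ideal_def)

lemma fps_ideal_antimono: "i \<le> j \<Longrightarrow> q \<in> fps_ideal j \<Longrightarrow> q \<in> fps_ideal i"
  by (auto simp: fps_ideal_def)

lemma fps_ideal_0 [simp]: "q \<in> fps_ideal 0" "0 \<in> fps_ideal j"
  by (auto simp: fps_ideal_def)

lemma fps_ideal_Suc: "q \<in> fps_ideal (Suc j) \<longleftrightarrow> q \<in> fps_ideal j \<and> int p dvd fps_nth q j"
  by (auto simp: fps_ideal_def less_Suc_eq)

lemma fps_ideal_mult:
  assumes "q \<in> fps_ideal i" "r \<in> fps_ideal j"
  shows "q * r \<in> fps_ideal (i + j)"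
proof -
  have "int p dvd fps_nth q l * fps_nth r (m - l)" if "m < i + j" "l \<le> m" for m l
  proof (cases "l < i")
    case True
    then show ?thesis using assms by (simp add: fps_ideal_def)
  next
    case False
    with that have "m - l < j" by linarith
    then show ?thesis using assms by (simp add: fps_ideal_def)
  qed
  then show ?thesis
    by (auto simp: fps_ideal_def fps_mult_nth intro!: dvd_sum)
qed

lemma fps_ideal_mult_left: "r \<in> fps_ideal j \<Longrightarrow> q * r \<in> fps_ideal j"
  using fps_ideal_mult[of q 0 r j] by simp

lemma fps_ideal_X_mult: "fps_X * q \<in> fps_ideal (Suc j) \<longleftrightarrow> q \<in> fps_ideal j"
  by (auto simp: fps_ideal_def less_Suc_eq_0_disj)

lemma fps_nth_of_nat_mult: "fps_nth (of_nat m * q :: int fps) i = int m * fps_nth q i"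
  by (simp flip: fps_of_nat)

lemma multiple_in_fps_ideal:
  assumes "of_nat p dvd (q :: int fps)"
  shows "q \<in> fps_ideal j"
  using assms by (auto simp: fps_ideal_def fps_nth_of_nat_mult elim!: dvdE)

text \<open>Sums of lamps are reduced entrywise, so \<open>lamp_series\<close> respects them only up
  to multiples of p; membership does not see the difference.\<close>

lemma fps_ideal_cong:
  assumes "of_nat p dvd (q - r)"
  shows "q \<in> fps_ideal j \<longleftrightarrow> r \<in> fps_ideal j"
  using fps_ideal_add[of "q - r" j r] fps_ideal_diff[of q j "q - r"]
    multiple_in_fps_ideal[OF assms, of j] by auto

text \<open>Frobenius: modulo p the middle binomial coefficients vanish, so (1 + r)^p becomes 1 +
  r^p, and r^p vanishes to p times the order of r.\<close>

lemma power_minus_1_in_fps_ideal: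
  assumes "q - 1 \<in> fps_ideal m" "0 < m"
  shows "q ^ p - 1 \<in> fps_ideal (p * m)"
proof -
  define r where "r = q - 1"
  have r: "r \<in> fps_ideal m" using assms by (simp add: r_def)
  have rpow: "r ^ k \<in> fps_ideal (k * m)" for k
    by (induction k) (auto intro: fps_ideal_mult r)
  have "q ^ p = (r + 1) ^ p" by (simp add: r_def)
  also have "\<dots> = (\<Sum>k\<le>p. of_nat (p choose k) * r ^ k)"
    by (simp add: binomial_ring)
  also have "{..p} = insert 0 (insert p {0<..<p})"
    using p_pos by auto
  also have "(\<Sum>k\<in>\<dots>. of_nat (p choose k) * r ^ k)
      = 1 + r ^ p + (\<Sum>k\<in>{0<..<p}. of_nat (p choose k) * r ^ k)"
    using p_pos by simp
  finally have "q ^ p - 1 = r ^ p + (\<Sum>k\<in>{0<..<p}. of_nat (p choose k) * r ^ k)"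
    by simp
  moreover have "of_nat p dvd (\<Sum>k\<in>{0<..<p}. of_nat (p choose k) * r ^ k)"
  proof (intro dvd_sum dvd_mult2)
    fix k assume "k \<in> {0<..<p}"
    then have "p dvd p choose k"
      using prime by (intro dvd_choose_prime) auto
    then show "of_nat p dvd (of_nat (p choose k) :: int fps)"
      by (auto elim!: dvdE)
  qed
  ultimately show ?thesis
    using rpow[of p] by (metis fps_ideal_add multiple_in_fps_ideal)
qed

text \<open>Iterated Frobenius gives t^n = 1 + X^n modulo p for n = p^a; only the divisibility by
  X^n is kept.\<close>

lemma tpow_prime_power: "tpow (int (p ^ a)) - 1 \<in> fps_ideal (p ^ a)"
proof (induction a)
  case 0
  then show ?case by (simp add: tpow_1 fps_ideal_def)
next
  case (Suc a)
  then show ?case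
    using power_minus_1_in_fps_ideal[of "tpow (int (p ^ a))" "p ^ a"] p_pos
    by (simp add: tpow_of_nat mult.commute power_mult[symmetric] del: of_nat_power of_nat_mult)
qed

lemma tpow_multiple:
  assumes "tpow m - 1 \<in> fps_ideal j"
  shows "tpow (m * k) - 1 \<in> fps_ideal j"
proof (induction k rule: int_induct[where k = 0])
  case (step1 k)
  have "tpow (m * (k + 1)) - 1 = tpow (m * k) * (tpow m - 1) + (tpow (m * k) - 1)"
    by (simp add: distrib_left tpow_add right_diff_distrib)
  then show ?case using step1 assms by (simp only:) (auto intro: fps_ideal_add fps_ideal_mult_left)
next
  case (step2 k)
  have "tpow (m * k) = tpow (m * (k - 1)) * tpow m"
    by (simp flip: tpow_add add: right_diff_distrib)
  then have "tpow (m * (k - 1)) - 1 = (tpow (m * k) - 1) - tpow (m * (k - 1)) * (tpow m - 1)"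
    by (simp add: right_diff_distrib)
  then show ?case using step2 assms by (simp only:) (auto intro: fps_ideal_diff fps_ideal_mult_left)
qed simp


section \<open>Lamp configurations modulo p, and division by t - 1\<close>

definition lamps :: "(int \<Rightarrow> int) set"
  where "lamps = {w. (\<forall>i. 0 \<le> w i \<and> w i < int p) \<and> finite {i. w i \<noteq> 0}}"

lemma carrier_lamp_group_eq: "carrier (lamp_group p) = lamps"
  using p_pos by (auto simp: lamps_def carrier_lamp_group carrier_integer_mod_group)

lemma finite_support: "w \<in> lamps \<Longrightarrow> finite {i. w i \<noteq> 0}"
  by (simp add: lamps_def)

lemma lamps_mod: "w \<in> lamps \<Longrightarrow> w i mod int p = w i"
  by (simp add: lamps_def)

definition reduce :: "(int \<Rightarrow> int) \<Rightarrow> int \<Rightarrow> int"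
  where "reduce w = (\<lambda>i. w i mod int p)"

lemma reduce_in_lamps: "finite {i. w i \<noteq> 0} \<Longrightarrow> reduce w \<in> lamps"
  using p_pos by (auto simp: lamps_def reduce_def elim!: finite_subset[rotated])

lemma zero_in_lamps [simp]: "(\<lambda>_. 0) \<in> lamps"
  using p_pos by (simp add: lamps_def)

lemma finite_support_shift: "finite {i. w i \<noteq> 0} \<Longrightarrow> finite {i. shift k w i \<noteq> 0}"
  by (simp add: support_shift)

lemma shift_in_lamps: "w \<in> lamps \<Longrightarrow> shift k w \<in> lamps"
  using finite_support_shift[of w k] by (auto simp: lamps_def shift_def)

lemma finite_support_add:
  fixes v w :: "int \<Rightarrow> int"
  assumes "finite {i. v i \<noteq> 0}" "finite {i. w i \<noteq> 0}"
  shows "finite {i. v i + w i \<noteq> 0}" and "finite {i. v i - w i \<noteq> 0}"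
  by (rule finite_subset[OF _ finite_UnI[OF assms]]; auto)+

lemma lamp_series_reduce:
  assumes "finite {i. w i \<noteq> 0}"
  shows "of_nat p dvd lamp_series (reduce w) - lamp_series w"
proof -
  let ?A = "{i. w i \<noteq> 0}"
  have "lamp_series (reduce w) - lamp_series w = (\<Sum>i\<in>?A. of_int (w i mod int p - w i) * tpow i)"
    using assms
    by (subst (1 2) lamp_series_eq_sum[of ?A])
      (auto simp: reduce_def sum_subtractf left_diff_distrib)
  moreover have "of_nat p dvd (of_int (w i mod int p - w i) :: int fps)" for i
  proof -
    have "int p dvd w i mod int p - w i"
      by (simp add: mod_eq_dvd_iff[symmetric])
    then obtain k where "w i mod int p - w i = int p * k" by (rule dvdE)
    then show ?thesis by (simp only:) simp
  qed
  ultimately show ?thesis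
    by (simp add: dvd_sum dvd_mult2)
qed

definition add_lamps :: "(int \<Rightarrow> int) \<Rightarrow> (int \<Rightarrow> int) \<Rightarrow> int \<Rightarrow> int"
  where "add_lamps v w = reduce (\<lambda>i. v i + w i)"

lemma add_lamps_in_lamps: "v \<in> lamps \<Longrightarrow> w \<in> lamps \<Longrightarrow> add_lamps v w \<in> lamps"
  unfolding add_lamps_def by (intro reduce_in_lamps finite_support_add finite_support)

lemma lamp_series_add_lamps:
  "v \<in> lamps \<Longrightarrow> w \<in> lamps \<Longrightarrow>
    of_nat p dvd lamp_series (add_lamps v w) - (lamp_series v + lamp_series w)"
  using lamp_series_reduce[of "\<lambda>i. v i + w i"] finite_support_add[of v w]
  by (simp add: add_lamps_def lamp_series_add finite_support)

text \<open>Multiplication by \<open>t - 1\<close>, which the substitution \<open>t = 1 + X\<close> turns into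
  multiplication by \<open>X\<close>.\<close>

definition diff_lamps :: "(int \<Rightarrow> int) \<Rightarrow> int \<Rightarrow> int"
  where "diff_lamps w = reduce (\<lambda>i. w (i - 1) - w i)"

lemma finite_support_diff:
  fixes w :: "int \<Rightarrow> int"
  assumes "finite {i. w i \<noteq> 0}"
  shows "finite {i. w (i - 1) - w i \<noteq> 0}"
  using finite_support_add(2)[OF finite_support_shift[OF assms, of 1] assms]
  by (simp add: shift_def)

lemma lamp_series_difference:
  assumes "finite {i. w i \<noteq> 0}"
  shows "lamp_series (\<lambda>i. w (i - 1) - w i) = fps_X * lamp_series w"
  using lamp_series_diff[OF finite_support_shift[OF assms, of 1] assms] lamp_series_shift[of 1 w]
  by (simp add: shift_def tpow_1 distrib_right)

lemma diff_lamps_in_lamps: "w \<in> lamps \<Longrightarrow> diff_lamps w \<in> lamps"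
  unfolding diff_lamps_def by (intro reduce_in_lamps finite_support_diff finite_support)

lemma lamp_series_diff_lamps:
  "w \<in> lamps \<Longrightarrow> of_nat p dvd lamp_series (diff_lamps w) - fps_X * lamp_series w"
  using lamp_series_reduce[OF finite_support_diff[OF finite_support]]
  by (simp add: diff_lamps_def lamp_series_difference finite_support)

lemma diff_lamps_in_ideal:
  "w \<in> lamps \<Longrightarrow> lamp_series (diff_lamps w) \<in> fps_ideal (Suc j) \<longleftrightarrow> lamp_series w \<in> fps_ideal j"
  using fps_ideal_cong[OF lamp_series_diff_lamps] by (simp add: fps_ideal_X_mult)

lemma diff_lamps_add: "diff_lamps (add_lamps v w) = add_lamps (diff_lamps v) (diff_lamps w)"
  by (simp add: diff_lamps_def add_lamps_def reduce_def fun_eq_iff mod_simps) (simp add: algebra_simps)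

lemma diff_lamps_shift: "diff_lamps (shift k w) = shift k (diff_lamps w)"
  by (simp add: diff_lamps_def reduce_def shift_def algebra_simps)

lemma diff_lamps_zero: "diff_lamps (\<lambda>_. 0) = (\<lambda>_. 0)"
  by (simp add: diff_lamps_def reduce_def)

text \<open>Laurent polynomials are X-adically dense: approximate (q - c)/X, where c is the constant
  term of \<open>q\<close>, then multiply by X = t - 1 and add c.\<close>

lemma ex_lamps_approx: "\<exists>w\<in>lamps. lamp_series w - q \<in> fps_ideal N"
proof (induction N arbitrary: q)
  case 0
  then show ?case using zero_in_lamps by (metis fps_ideal_0(1))
next
  case (Suc N)
  obtain w where w: "w \<in> lamps" "lamp_series w - fps_shift 1 q \<in> fps_ideal N"
    using Suc by blast
  define c where "c = fps_nth q 0"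
  define v where "v = (\<lambda>i. (w (i - 1) - w i) + (if i = 0 then c else 0))"
  have fin: "finite {i. w (i - 1) - w i \<noteq> 0}" "finite {i::int. (if i = 0 then c else 0) \<noteq> 0}"
    using finite_support_diff[OF finite_support[OF w(1)]] by simp_all
  have v: "finite {i. v i \<noteq> 0}"
    unfolding v_def by (rule finite_support_add[OF fin])
  have "lamp_series v = fps_X * lamp_series w + of_int c"
    unfolding v_def using w
    by (simp add: lamp_series_add[OF fin] lamp_series_difference finite_support)
  moreover have "q = fps_X * fps_shift 1 q + of_int c"
    by (rule fps_ext, simp add: c_def flip: fps_of_int)
  ultimately have "lamp_series v - q = fps_X * (lamp_series w - fps_shift 1 q)"
    by (metis add_diff_cancel_right right_diff_distrib)
  then have "lamp_series v - q \<in> fps_ideal (Suc N)"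
    using w by (simp add: fps_ideal_X_mult)
  then have "lamp_series (reduce v) - q \<in> fps_ideal (Suc N)"
    using fps_ideal_cong[of "lamp_series (reduce v) - q" "lamp_series v - q"] lamp_series_reduce[OF v]
    by simp
  then show ?case using reduce_in_lamps[OF v] by blast
qed

text \<open>The constant coefficient in X is the value at t = 1, the sum of the entries; if p
  divides it, then t - 1 divides \<open>w\<close> modulo p. The shrinking window makes repeated
  division terminate.\<close>

lemma ex_diff_lamps:
  assumes w: "w \<in> lamps" and supp: "{i. w i \<noteq> 0} \<subseteq> {a..<a + int (Suc d)}"
    and dvd: "lamp_series w \<in> fps_ideal (Suc j)"
  shows "\<exists>v\<in>lamps. {i. v i \<noteq> 0} \<subseteq> {a..<a + int d} \<and> w = diff_lamps v"
proof -
  \<comment> \<open>Minus the partial sums solve v(i - 1) - v(i) = w(i).\<close>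
  define v where "v = (\<lambda>i. (- (\<Sum>l\<in>{a..i}. w l)) mod int p)"
  have "fps_nth (lamp_series w) 0 = (\<Sum>i\<in>{a..<a + int (Suc d)}. w i)"
    by (subst lamp_series_eq_sum[OF _ supp]) (simp_all add: fps_sum_nth flip: fps_of_int)
  moreover have "int p dvd fps_nth (lamp_series w) 0"
    using dvd by (simp add: fps_ideal_def)
  ultimately have total: "int p dvd (\<Sum>i\<in>{a..<a + int (Suc d)}. w i)"
    by simp
  have supp_v: "{i. v i \<noteq> 0} \<subseteq> {a..<a + int d}"
  proof (rule ccontr)
    assume "\<not> {i. v i \<noteq> 0} \<subseteq> {a..<a + int d}"
    then obtain i where i: "v i \<noteq> 0" "i \<notin> {a..<a + int d}" by blast
    show False
    proof (cases "i < a")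
      case True
      then show False using i by (simp add: v_def)
    next
      case False
      \<comment> \<open>From the last position of the window on, the partial sum is the total, which
        p divides.\<close>
      have "(\<Sum>l\<in>{a..i}. w l) = (\<Sum>l\<in>{a..<a + int (Suc d)}. w l)"
        using supp i False by (intro sum.mono_neutral_right) auto
      then show False using i total by (simp add: v_def mod_eq_0_iff_dvd)
    qed
  qed
  have "finite {i. v i \<noteq> 0}"
    using supp_v finite_subset by blast
  then have v: "v \<in> lamps"
    using p_pos by (simp add: lamps_def v_def)
  have "w i = diff_lamps v i" for i
  proof (cases "a \<le> i")
    case True
    then have "{a..i} = insert i {a..i - 1}" by auto
    then have "(\<Sum>l\<in>{a..i}. w l) = w i + (\<Sum>l\<in>{a..i - 1}. w l)" by simp
    then have "diff_lamps v i = w i mod int p"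
      by (simp add: diff_lamps_def reduce_def v_def mod_simps)
    then show ?thesis using lamps_mod[OF w] by simp
  next
    case False
    then have "w i = 0" using supp by auto
    then show ?thesis using False by (simp add: diff_lamps_def reduce_def v_def)
  qed
  then show ?thesis using v supp_v by blast
qed

lemma finite_support_bounded:
  fixes w :: "int \<Rightarrow> int"
  assumes "finite {i. w i \<noteq> 0}"
  obtains a d where "{i. w i \<noteq> 0} \<subseteq> {a..<a + int d}"
proof -
  obtain B where B: "\<And>i. w i \<noteq> 0 \<Longrightarrow> \<bar>i\<bar> \<le> B"
    using assms by (metis (mono_tags) Max_ge finite_imageI imageI mem_Collect_eq)
  have "i \<in> {- \<bar>B\<bar>..<- \<bar>B\<bar> + int (nat (2 * \<bar>B\<bar> + 1))}" if "w i \<noteq> 0" for i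
    using B[OF that] by auto
  then show thesis using that by blast
qed

text \<open>Each division by t - 1 shortens the window around the support by one, so after d
  divisions nothing is left.\<close>

lemma lamps_eq_zero:
  assumes "w \<in> lamps" "\<And>j. lamp_series w \<in> fps_ideal j"
  shows "w = (\<lambda>_. 0)"
proof -
  have "w = (\<lambda>_. 0)"
    if "w \<in> lamps" "{i. w i \<noteq> 0} \<subseteq> {a..<a + int d}" "lamp_series w \<in> fps_ideal d" for w a d
    using that
  proof (induction d arbitrary: w)
    case 0
    then show ?case by auto
  next
    case (Suc d)
    obtain v where v: "v \<in> lamps" "{i. v i \<noteq> 0} \<subseteq> {a..<a + int d}" "w = diff_lamps v"
      using ex_diff_lamps[OF Suc.prems] by blast
    then have "v = (\<lambda>_. 0)"
      using Suc.IH Suc.prems by (simp add: diff_lamps_in_ideal)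
    then show ?case using v diff_lamps_zero by simp
  qed
  then show ?thesis
    using assms finite_support_bounded[OF finite_support] by metis
qed

text \<open>The lamps of (t - 1)^j, which represent X^j modulo p.\<close>

definition diff_power :: "nat \<Rightarrow> int \<Rightarrow> int"
  where "diff_power j = (diff_lamps ^^ j) (\<lambda>i. if i = 0 then 1 else 0)"

lemma diff_power_Suc: "diff_power (Suc j) = diff_lamps (diff_power j)"
  by (simp add: diff_power_def)

lemma diff_power_in_lamps: "diff_power j \<in> lamps"
proof (induction j)
  case 0
  then show ?case using p_gt_1 by (simp add: diff_power_def lamps_def)
qed (simp add: diff_power_Suc diff_lamps_in_lamps)

lemma diff_power_in_ideal: "lamp_series (diff_power j) \<in> fps_ideal j"
  by (induction j) (simp_all add: diff_power_Suc diff_lamps_in_ideal diff_power_in_lamps)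

text \<open>Every entry is a natural number below p, hence a repeated sum of one single lamp;
  positions of the support are then removed one at a time.\<close>

lemma lamps_generated_by_single_lamps:
  assumes zero: "(\<lambda>_. 0) \<in> N" and add: "\<And>v w. v \<in> N \<Longrightarrow> w \<in> N \<Longrightarrow> add_lamps v w \<in> N"
    and single: "\<And>b. shift b (diff_power 0) \<in> N"
  shows "lamps \<subseteq> N"
proof
  have multiple: "reduce (\<lambda>i. if i = b then int c else 0) \<in> N" for b c
  proof (induction c)
    case 0
    then show ?case using zero by (simp add: reduce_def)
  next
    case (Suc c)
    have "add_lamps (shift b (diff_power 0)) (reduce (\<lambda>i. if i = b then int c else 0)) \<in> N"
      by (intro add single Suc)
    also have "add_lamps (shift b (diff_power 0)) (reduce (\<lambda>i. if i = b then int c else 0))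
        = reduce (\<lambda>i. if i = b then int (Suc c) else 0)"
      by (auto simp: add_lamps_def reduce_def diff_power_def shift_def fun_eq_iff mod_simps)
    finally show ?case .
  qed
  fix w assume w: "w \<in> lamps"
  have "w \<in> N" if "finite A" "w \<in> lamps" "{i. w i \<noteq> 0} \<subseteq> A" for A w
    using that
  proof (induction A arbitrary: w rule: finite_induct)
    case empty
    then have "w = (\<lambda>_. 0)" by auto
    then show ?case using zero by simp
  next
    case (insert b A)
    have "{i. (w(b := 0)) i \<noteq> 0} \<subseteq> A" using insert by auto
    moreover from this have "w(b := 0) \<in> lamps"
      using insert.prems(1) insert.hyps(1) p_pos finite_subset[of "{i. (w(b := 0)) i \<noteq> 0}" A]
      unfolding lamps_def by simp
    ultimately have "w(b := 0) \<in> N" by (intro insert.IH)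
    then have "add_lamps (w(b := 0)) (reduce (\<lambda>i. if i = b then int (nat (w b)) else 0)) \<in> N"
      by (intro add multiple)
    also have "add_lamps (w(b := 0)) (reduce (\<lambda>i. if i = b then int (nat (w b)) else 0)) = w"
      using insert.prems(1) by (auto simp: add_lamps_def reduce_def lamps_def)
    finally show ?case .
  qed
  then show "w \<in> N" using w finite_support by blast
qed

text \<open>Dividing \<open>w\<close> by t - 1 lowers j by one, and the preimage of \<open>N\<close>
  under multiplication by t - 1 satisfies the hypotheses for the smaller exponent; this is why the
  induction varies \<open>N\<close>.\<close>

lemma ideal_generated_by_shifts:
  assumes "(\<lambda>_. 0) \<in> N" "\<And>v w. v \<in> N \<Longrightarrow> w \<in> N \<Longrightarrow> add_lamps v w \<in> N"
    and "\<And>b. shift b (diff_power j) \<in> N"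
    and "w \<in> lamps" "lamp_series w \<in> fps_ideal j"
  shows "w \<in> N"
  using assms
proof (induction j arbitrary: N w)
  case 0
  then show ?case using lamps_generated_by_single_lamps[of N] by blast
next
  case (Suc j)
  obtain a d where "{i. w i \<noteq> 0} \<subseteq> {a..<a + int d}"
    using finite_support_bounded[OF finite_support[OF Suc.prems(4)]] .
  then have "{i. w i \<noteq> 0} \<subseteq> {a..<a + int (Suc d)}" by force
  then obtain v where v: "v \<in> lamps" "w = diff_lamps v"
    using ex_diff_lamps[OF Suc.prems(4) _ Suc.prems(5)] by blast
  have "v \<in> {v. diff_lamps v \<in> N}"
  proof (rule Suc.IH)
    show "lamp_series v \<in> fps_ideal j"
      using v Suc.prems(5) by (simp add: diff_lamps_in_ideal)
  qed (use Suc.prems v in \<open>auto simp: diff_lamps_zero diff_lamps_add diff_lamps_shift diff_power_Suc\<close>)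
  then show ?case using v by simp
qed

end

section \<open>Maps onto elementary abelian groups\<close>

text \<open>Modulo p, \<open>\<chi>\<close> is a homomorphism onto Z/p, and the first isomorphism
  theorem counts the cosets. Integer values that are additive only modulo p let coefficients of
  series serve as \<open>\<chi>\<close>.\<close>

lemma (in group) kernel_of_surjection_mod:
  fixes \<chi> :: "'a \<Rightarrow> int"
  assumes p: "0 < p"
    and mult: "\<And>x y. x \<in> carrier G \<Longrightarrow> y \<in> carrier G \<Longrightarrow> int p dvd \<chi> (x \<otimes> y) - (\<chi> x + \<chi> y)"
    and onto: "\<exists>x\<in>carrier G. int p dvd \<chi> x - 1"
  shows "{x \<in> carrier G. int p dvd \<chi> x} \<lhd> G"
    and "subgroup_index G {x \<in> carrier G. int p dvd \<chi> x} = p"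
proof -
  let ?Z = "integer_mod_group p" and ?h = "\<lambda>x. \<chi> x mod int p"
  have hom: "?h \<in> hom G ?Z"
  proof (rule homI)
    fix x y assume "x \<in> carrier G" "y \<in> carrier G"
    then show "?h (x \<otimes> y) = ?h x \<otimes>\<^bsub>?Z\<^esub> ?h y"
      using mult[of x y] by (simp add: mod_eq_dvd_iff[symmetric] mod_simps)
  qed (use p in \<open>simp add: carrier_integer_mod_group\<close>)
  interpret h: group_hom G ?Z ?h
    using hom by (intro group_hom.intro group_hom_axioms.intro is_group group_integer_mod_group)
  have ker: "kernel G ?Z ?h = {x \<in> carrier G. int p dvd \<chi> x}"
    by (auto simp: kernel_def)
  show "{x \<in> carrier G. int p dvd \<chi> x} \<lhd> G"
    using h.normal_kernel by (simp add: ker)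
  obtain x where x: "x \<in> carrier G" "?h x = 1 mod int p"
    using onto by (auto simp: mod_eq_dvd_iff)
  \<comment> \<open>Powers of an element of value 1 reach every residue.\<close>
  have pow: "?h (x [^] n) = int n mod int p" for n :: nat
    using h.hom_nat_pow[OF x(1), of n] x(2) by (simp add: mod_simps)
  have "?h ` carrier G = carrier ?Z"
  proof
    show "carrier ?Z \<subseteq> ?h ` carrier G"
    proof
      fix c assume c: "c \<in> carrier ?Z"
      then have "c = ?h (x [^] nat c)"
        unfolding pow using p by (simp add: carrier_integer_mod_group)
      then show "c \<in> ?h ` carrier G" using x(1) by blast
    qed
  qed (use h.hom_closed in blast)
  then have "(\<lambda>C. the_elem (?h ` C)) \<in> iso (G Mod kernel G ?Z ?h) ?Z"
    by (rule h.FactGroup_iso_set)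
  then have "bij_betw (\<lambda>C. the_elem (?h ` C)) (carrier (G Mod kernel G ?Z ?h)) (carrier ?Z)"
    by (simp add: iso_def)
  then have "card (carrier (G Mod kernel G ?Z ?h)) = card (carrier ?Z)"
    by (rule bij_betw_same_card)
  then show "subgroup_index G {x \<in> carrier G. int p dvd \<chi> x} = p"
    using p by (simp add: FactGroup_def ker subgroup_index_def carrier_integer_mod_group)
qed

text \<open>Modulo p, \<open>\<psi>\<close> maps the group onto (Z/p)^m, and the images of
  \<open>S\<close> span; counting coefficient vectors gives p^m \<le> p^(card S).\<close>

lemma (in group) card_generators_ge:
  fixes \<psi> :: "'a \<Rightarrow> nat \<Rightarrow> int"
  assumes p: "1 < p" and S: "S \<subseteq> carrier G" "finite S" "generate G S = carrier G"
    and mult: "\<And>x y i. x \<in> carrier G \<Longrightarrow> y \<in> carrier G \<Longrightarrow> i < m \<Longrightarrow>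
      int p dvd \<psi> (x \<otimes> y) i - (\<psi> x i + \<psi> y i)"
    and onto: "\<And>v. \<exists>x\<in>carrier G. \<forall>i<m. int p dvd \<psi> x i - v i"
  shows "m \<le> card S"
proof -
  have mult': "\<psi> (x \<otimes> y) i mod int p = (\<psi> x i + \<psi> y i) mod int p"
    if "x \<in> carrier G" "y \<in> carrier G" "i < m" for x y i
    using mult[OF that] by (simp add: mod_eq_dvd_iff)
  have one: "\<psi> \<one> i mod int p = 0" if "i < m" for i
  proof -
    have "int p dvd \<psi> \<one> i - (\<psi> \<one> i + \<psi> \<one> i)"
      using mult[of \<one> \<one> i] that by simp
    then show ?thesis by simp
  qed
  have inv: "\<psi> (inv x) i mod int p = (- \<psi> x i) mod int p" if "x \<in> carrier G" "i < m" for x i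
  proof -
    have "(\<psi> x i + \<psi> (inv x) i) mod int p = 0"
      using mult'[of x "inv x" i] one[of i] that by simp
    then have "int p dvd \<psi> (inv x) i - (- \<psi> x i)"
      by (simp add: add.commute mod_eq_0_iff_dvd)
    then show ?thesis by (simp add: mod_eq_dvd_iff)
  qed
  have combination: "\<exists>c. \<forall>i<m. \<psi> x i mod int p = (\<Sum>s\<in>S. c s * \<psi> s i) mod int p"
    if "x \<in> generate G S" for x
    using that
  proof induction
    case one
    then show ?case using \<open>\<And>i. i < m \<Longrightarrow> \<psi> \<one> i mod int p = 0\<close> by (auto intro!: exI[of _ "\<lambda>_. 0"])
  next
    case (incl h)
    then show ?case
      using S by (auto intro!: exI[of _ "\<lambda>s. if s = h then 1 else 0"] simp: if_distrib if_distribR cong: if_cong)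
  next
    case (inv h)
    then have "h \<in> carrier G" using S by auto
    with inv show ?case
      using S \<open>\<And>x i. x \<in> carrier G \<Longrightarrow> i < m \<Longrightarrow> \<psi> (inv x) i mod int p = (- \<psi> x i) mod int p\<close>
      by (auto intro!: exI[of _ "\<lambda>s. if s = h then -1 else 0"] simp: if_distrib if_distribR cong: if_cong)
  next
    case (eng x y)
    then obtain c d where
      c: "\<forall>i<m. \<psi> x i mod int p = (\<Sum>s\<in>S. c s * \<psi> s i) mod int p" and
      d: "\<forall>i<m. \<psi> y i mod int p = (\<Sum>s\<in>S. d s * \<psi> s i) mod int p"
      by blast
    have xy: "x \<in> carrier G" "y \<in> carrier G" using eng.hyps S by auto
    have "\<psi> (x \<otimes> y) i mod int p = (\<Sum>s\<in>S. (c s + d s) * \<psi> s i) mod int p" if "i < m" for i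
    proof -
      have "\<psi> (x \<otimes> y) i mod int p = (\<psi> x i mod int p + \<psi> y i mod int p) mod int p"
        using mult' xy that by (simp add: mod_simps)
      also have "\<dots> = (\<Sum>s\<in>S. (c s + d s) * \<psi> s i) mod int p"
        using c d that by (simp add: mod_simps distrib_right sum.distrib)
      finally show ?thesis .
    qed
    then show ?case by (intro exI[of _ "\<lambda>s. c s + d s"]) blast
  qed
  let ?P = "\<lambda>A. A \<rightarrow>\<^sub>E {0..<int p}"
  \<comment> \<open>\<open>?F\<close> sends a coefficient vector on \<open>S\<close> to its linear
    combination of the images.\<close>
  let ?F = "\<lambda>c. \<lambda>i\<in>{..<m}. (\<Sum>s\<in>S. c s * \<psi> s i) mod int p"
  have "?P {..<m} \<subseteq> ?F ` ?P S"
  proof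
    fix v assume v: "v \<in> ?P {..<m}"
    obtain x where x: "x \<in> carrier G" "\<And>i. i < m \<Longrightarrow> \<psi> x i mod int p = v i mod int p"
      using onto[of v] by (auto simp: mod_eq_dvd_iff)
    obtain c where c: "\<And>i. i < m \<Longrightarrow> \<psi> x i mod int p = (\<Sum>s\<in>S. c s * \<psi> s i) mod int p"
      using combination[of x] x(1) S(3) by blast
    let ?c = "\<lambda>s\<in>S. c s mod int p"
    have "?c \<in> ?P S" using p by auto
    moreover have "v = ?F ?c"
    proof (rule PiE_ext[OF v])
      show "?F ?c \<in> ?P {..<m}" using p by auto
      fix i assume "i \<in> {..<m}"
      then have i: "i < m" by simp
      have "v i = v i mod int p" using PiE_mem[OF v, of i] i by simp
      also have "\<dots> = (\<Sum>s\<in>S. c s * \<psi> s i) mod int p"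
        using x(2)[OF i] c[OF i] by simp
      also have "\<dots> = (\<Sum>s\<in>S. (c s * \<psi> s i) mod int p) mod int p"
        by (simp add: mod_sum_eq)
      also have "\<dots> = (\<Sum>s\<in>S. (?c s * \<psi> s i) mod int p) mod int p"
        by (simp add: mod_mult_left_eq)
      also have "\<dots> = ?F ?c i" using i by (simp only: mod_sum_eq) simp
      finally show "v i = ?F ?c i" .
    qed
    ultimately show "v \<in> ?F ` ?P S" by blast
  qed
  then have "card (?P {..<m}) \<le> card (?P S)"
    using S(2) by (intro surj_card_le finite_PiE) auto
  then have "p ^ m \<le> p ^ card S"
    using S(2) by (simp add: card_PiE)
  then show ?thesis
    using p power_le_imp_le_exp by blast
qed

context prime_modulus
begin

section \<open>Subgroups of the lamplighter group\<close>

abbreviation L where "L \<equiv> lamplighter_group p"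

lemma carrier_lamplighter: "carrier L = lamps \<times> UNIV"
  by (simp add: lamplighter_group_def semidirect_product_def carrier_lamp_group_eq)

lemma mult_lamplighter:
  "x \<otimes>\<^bsub>L\<^esub> y = (add_lamps (fst x) (shift (snd x) (fst y)), snd x + snd y)"
  by (simp add: lamplighter_group_def semidirect_product_def lamp_group_def add_lamps_def
      reduce_def restrict_UNIV case_prod_beta)

lemma one_lamplighter: "\<one>\<^bsub>L\<^esub> = (\<lambda>_. 0, 0)"
  by (simp add: lamplighter_group_def semidirect_product_def lamp_group_def restrict_UNIV)

sublocale lamplighter: group L
  by (rule group_lamplighter_group)

lemma snd_inv_lamplighter:
  assumes "x \<in> carrier L"
  shows "snd (inv\<^bsub>L\<^esub> x) = - snd x"
proof -
  have "snd (x \<otimes>\<^bsub>L\<^esub> inv\<^bsub>L\<^esub> x) = 0"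
    using assms by (simp add: one_lamplighter)
  then show ?thesis by (simp add: mult_lamplighter)
qed

text \<open>Lamps commute with each other, so conjugation acts through the shift alone, as
  multiplication by a power of t.\<close>

lemma conjugate_lamp:
  assumes "z \<in> carrier L" "w \<in> lamps"
  shows "z \<otimes>\<^bsub>L\<^esub> (w, 0) \<otimes>\<^bsub>L\<^esub> inv\<^bsub>L\<^esub> z = (shift (snd z) w, 0)"
proof -
  have "z \<otimes>\<^bsub>L\<^esub> (w, 0) = (shift (snd z) w, 0) \<otimes>\<^bsub>L\<^esub> z"
    by (simp add: mult_lamplighter add_lamps_def shift_def add.commute)
  moreover have "(shift (snd z) w, 0) \<in> carrier L"
    using assms(2) by (simp add: carrier_lamplighter shift_in_lamps)
  ultimately show ?thesis
    using assms(1) by (simp add: lamplighter.m_assoc)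
qed

text \<open>After the substitution \<open>t = 1 + X\<close>, conjugation by \<open>u\<close> carries \<open>(w, k)\<close> to a pair whose
  first component is this series.\<close>

definition cocycle :: "int fps \<Rightarrow> (int \<Rightarrow> int) \<times> int \<Rightarrow> int fps"
  where "cocycle u x = lamp_series (fst x) - u * (tpow (snd x) - 1)"

text \<open>This is t^(k+l) - 1 = (t^k - 1) + t^k (t^l - 1), with an error that comes only from
  reducing entries modulo p.\<close>

lemma cocycle_mult:
  assumes "x \<in> carrier L" "y \<in> carrier L"
  shows "of_nat p dvd cocycle u (x \<otimes>\<^bsub>L\<^esub> y) - (cocycle u x + tpow (snd x) * cocycle u y)"
proof -
  have "cocycle u (x \<otimes>\<^bsub>L\<^esub> y) - (cocycle u x + tpow (snd x) * cocycle u y) =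
      lamp_series (add_lamps (fst x) (shift (snd x) (fst y))) -
      (lamp_series (fst x) + lamp_series (shift (snd x) (fst y)))"
    by (simp add: cocycle_def mult_lamplighter tpow_add lamp_series_shift algebra_simps)
  then show ?thesis
    using assms lamp_series_add_lamps[of "fst x" "shift (snd x) (fst y)"]
    by (auto simp: carrier_lamplighter shift_in_lamps)
qed

lemma cocycle_one: "cocycle u \<one>\<^bsub>L\<^esub> = 0"
  by (simp add: cocycle_def one_lamplighter)

text \<open>These are the elements that conjugation by \<open>u\<close> carries to pairs with lamps
  in (X^j) and shift divisible by n. As \<open>u\<close> need not be a Laurent polynomial, that
  conjugation may leave \<open>L\<close>.\<close>

definition layer :: "int fps \<Rightarrow> nat \<Rightarrow> nat \<Rightarrow> ((int \<Rightarrow> int) \<times> int) set"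
  where "layer u n j = {x \<in> carrier L. int n dvd snd x \<and> cocycle u x \<in> fps_ideal j}"

lemma subgroup_layer: "subgroup (layer u n j) L"
proof (rule lamplighter.subgroupI)
  show "layer u n j \<noteq> {}"
    using lamplighter.one_closed cocycle_one[of u] unfolding layer_def one_lamplighter by force
next
  fix x y assume "x \<in> layer u n j" "y \<in> layer u n j"
  then show "x \<otimes>\<^bsub>L\<^esub> y \<in> layer u n j"
    using fps_ideal_cong[OF cocycle_mult[of x y u]]
    by (simp add: layer_def fps_ideal_add fps_ideal_mult_left) (simp add: mult_lamplighter)
next
  fix x assume x: "x \<in> layer u n j"
  let ?y = "inv\<^bsub>L\<^esub> x"
  have xy: "x \<in> carrier L" "?y \<in> carrier L" using x by (auto simp: layer_def)
  have "cocycle u x + tpow (snd x) * cocycle u ?y \<in> fps_ideal j"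
    using fps_ideal_cong[OF cocycle_mult[OF xy, of u], of j] xy by (simp add: cocycle_one)
  then have "tpow (snd x) * cocycle u ?y \<in> fps_ideal j"
    using x fps_ideal_diff[of "cocycle u x + tpow (snd x) * cocycle u ?y" j "cocycle u x"]
    by (simp add: layer_def)
  \<comment> \<open>A power of t is a unit and can be cancelled.\<close>
  from fps_ideal_mult_left[OF this, of "tpow (- snd x)"] have "cocycle u ?y \<in> fps_ideal j"
    by (simp add: tpow_minus_cancel flip: mult.assoc)
  then show "?y \<in> layer u n j"
    using x xy by (simp add: layer_def snd_inv_lamplighter)
qed (auto simp: layer_def)

lemma group_layer: "group (L\<lparr>carrier := layer u n j\<rparr>)"
  by (rule lamplighter.subgroup_imp_group[OF subgroup_layer])

text \<open>Density of Laurent polynomials lets shift and cocycle be prescribed independently, the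
  cocycle to any finite precision. The surjectivity claims below rest on this.\<close>

lemma ex_layer:
  assumes "int n dvd k" "q \<in> fps_ideal j"
  shows "\<exists>x\<in>layer u n j. snd x = k \<and> cocycle u x - q \<in> fps_ideal N"
proof -
  \<comment> \<open>Precision j puts the element into the layer, precision \<open>N\<close> brings
    the cocycle close to \<open>q\<close>.\<close>
  obtain w where w: "w \<in> lamps" "lamp_series w - (q + u * (tpow k - 1)) \<in> fps_ideal (max j N)"
    using ex_lamps_approx by blast
  have "cocycle u (w, k) - q \<in> fps_ideal (max j N)"
    using w(2) by (simp add: cocycle_def algebra_simps)
  then have diff: "cocycle u (w, k) - q \<in> fps_ideal j" "cocycle u (w, k) - q \<in> fps_ideal N"
    using fps_ideal_antimono max.cobounded1 max.cobounded2 by blast+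
  then have "cocycle u (w, k) \<in> fps_ideal j"
    using fps_ideal_add[OF diff(1) assms(2)] by simp
  then show ?thesis
    using w(1) diff(2) assms(1) by (intro bexI[of _ "(w, k)"]) (auto simp: layer_def carrier_lamplighter)
qed

lemma layer_0: "layer u 1 0 = carrier L"
  by (auto simp: layer_def)

lemma X_power_in_ideal: "fps_X ^ j \<in> fps_ideal j"
  by (simp add: fps_ideal_def fps_X_power_nth)

lemma tpow_in_ideal_1: "tpow k - 1 \<in> fps_ideal 1"
  by (simp add: fps_ideal_def)

text \<open>The next layer is the kernel of the coefficient of X^j in the cocycle. This coefficient
  is additive modulo p because the twist t^k is 1 modulo X.\<close>

lemma layer_Suc:
  shows "layer u n (Suc j) \<lhd> L\<lparr>carrier := layer u n j\<rparr>"
    and "subgroup_index (L\<lparr>carrier := layer u n j\<rparr>) (layer u n (Suc j)) = p"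
proof -
  interpret K: group "L\<lparr>carrier := layer u n j\<rparr>" by (rule group_layer)
  let ?\<chi> = "\<lambda>x. fps_nth (cocycle u x) j"
  have eq: "{x \<in> carrier (L\<lparr>carrier := layer u n j\<rparr>). int p dvd ?\<chi> x} = layer u n (Suc j)"
    by (auto simp: layer_def fps_ideal_Suc)
  have mult: "int p dvd ?\<chi> (x \<otimes>\<^bsub>L\<^esub> y) - (?\<chi> x + ?\<chi> y)"
    if "x \<in> layer u n j" "y \<in> layer u n j" for x y
  proof -
    have "(tpow (snd x) - 1) * cocycle u y \<in> fps_ideal (1 + j)"
      using that by (intro fps_ideal_mult tpow_in_ideal_1) (simp add: layer_def)
    moreover have "cocycle u (x \<otimes>\<^bsub>L\<^esub> y) - (cocycle u x + tpow (snd x) * cocycle u y) \<in> fps_ideal (1 + j)"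
      using that by (intro multiple_in_fps_ideal cocycle_mult) (auto simp: layer_def)
    ultimately have "cocycle u (x \<otimes>\<^bsub>L\<^esub> y) - (cocycle u x + cocycle u y) \<in> fps_ideal (1 + j)"
      using fps_ideal_add by (fastforce simp: algebra_simps)
    then show ?thesis by (simp add: fps_ideal_def)
  qed
  obtain x where "x \<in> layer u n j" "cocycle u x - fps_X ^ j \<in> fps_ideal (Suc j)"
    using ex_layer[OF dvd_0_right X_power_in_ideal] by blast
  then have onto: "\<exists>x\<in>layer u n j. int p dvd ?\<chi> x - 1"
    by (auto simp: fps_ideal_Suc)
  show "layer u n (Suc j) \<lhd> L\<lparr>carrier := layer u n j\<rparr>"
    using K.kernel_of_surjection_mod(1)[of p ?\<chi>] p_pos mult onto unfolding eq by simp
  show "subgroup_index (L\<lparr>carrier := layer u n j\<rparr>) (layer u n (Suc j)) = p"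
    using K.kernel_of_surjection_mod(2)[of p ?\<chi>] p_pos mult onto unfolding eq by simp
qed

text \<open>Here the homomorphism onto Z/p is the shift divided by n.\<close>

lemma layer_mult:
  assumes n: "0 < n"
  shows "layer u (p * n) j \<lhd> L\<lparr>carrier := layer u n j\<rparr>"
    and "subgroup_index (L\<lparr>carrier := layer u n j\<rparr>) (layer u (p * n) j) = p"
proof -
  interpret K: group "L\<lparr>carrier := layer u n j\<rparr>" by (rule group_layer)
  let ?\<chi> = "\<lambda>x :: (int \<Rightarrow> int) \<times> int. snd x div int n"
  have "int (p * n) dvd k \<longleftrightarrow> int n dvd k \<and> int p dvd k div int n" for k
    using n by (auto simp: mult.commute elim!: dvdE)
  then have eq: "{x \<in> carrier (L\<lparr>carrier := layer u n j\<rparr>). int p dvd ?\<chi> x} = layer u (p * n) j"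
    by (auto simp: layer_def)
  have mult: "int p dvd ?\<chi> (x \<otimes>\<^bsub>L\<^esub> y) - (?\<chi> x + ?\<chi> y)"
    if "x \<in> layer u n j" "y \<in> layer u n j" for x y
    using that by (simp add: layer_def mult_lamplighter div_plus_div_distrib_dvd_left)
  obtain x where "x \<in> layer u n j" "snd x = int n"
    using ex_layer[OF dvd_refl fps_ideal_0(2)] by blast
  then have onto: "\<exists>x\<in>layer u n j. int p dvd ?\<chi> x - 1"
    using n by (intro bexI[of _ x]) auto
  show "layer u (p * n) j \<lhd> L\<lparr>carrier := layer u n j\<rparr>"
    using K.kernel_of_surjection_mod(1)[of p ?\<chi>] p_pos mult onto unfolding eq by simp
  show "subgroup_index (L\<lparr>carrier := layer u n j\<rparr>) (layer u (p * n) j) = p"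
    using K.kernel_of_surjection_mod(2)[of p ?\<chi>] p_pos mult onto unfolding eq by simp
qed

section \<open>Minimal number of generators of a layer\<close>

text \<open>Shifts in the layer are multiples of n, so t^k is 1 modulo X^n and the n coefficients
  from X^j on are all additive modulo p. With the shift divided by n they map onto
  (Z/p)^(n+1).\<close>

lemma card_generators_layer_ge:
  assumes n: "0 < n" and tpow_n: "tpow (int n) - 1 \<in> fps_ideal n"
    and S: "S \<subseteq> layer u n j" "finite S" "generate (L\<lparr>carrier := layer u n j\<rparr>) S = layer u n j"
  shows "Suc n \<le> card S"
proof -
  interpret K: group "L\<lparr>carrier := layer u n j\<rparr>" by (rule group_layer)
  let ?\<psi> = "\<lambda>x i. if i < n then fps_nth (cocycle u x) (j + i) else snd x div int n"
  have mult: "int p dvd ?\<psi> (x \<otimes>\<^bsub>L\<^esub> y) i - (?\<psi> x i + ?\<psi> y i)"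
    if "x \<in> layer u n j" "y \<in> layer u n j" for x y i
  proof (cases "i < n")
    case True
    have "int n dvd snd x" using that(1) by (simp add: layer_def)
    then obtain k where k: "snd x = int n * k" by (rule dvdE)
    have "(tpow (snd x) - 1) * cocycle u y \<in> fps_ideal (n + j)"
      using that tpow_multiple[OF tpow_n] by (intro fps_ideal_mult) (simp_all add: layer_def k)
    moreover have "cocycle u (x \<otimes>\<^bsub>L\<^esub> y) - (cocycle u x + tpow (snd x) * cocycle u y) \<in> fps_ideal (n + j)"
      using that by (intro multiple_in_fps_ideal cocycle_mult) (auto simp: layer_def)
    ultimately have "cocycle u (x \<otimes>\<^bsub>L\<^esub> y) - (cocycle u x + cocycle u y) \<in> fps_ideal (n + j)"
      using fps_ideal_add by (fastforce simp: algebra_simps)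
    then show ?thesis using True by (simp add: fps_ideal_def)
  next
    case False
    then show ?thesis
      using that by (simp add: layer_def mult_lamplighter div_plus_div_distrib_dvd_left)
  qed
  have onto: "\<exists>x\<in>layer u n j. \<forall>i<Suc n. int p dvd ?\<psi> x i - v i" for v
  proof -
    \<comment> \<open>The prescribed coefficients are moved up to start in degree j; v(n) is
      reserved for the shift.\<close>
    define q where "q = Abs_fps (\<lambda>i. if i < j then 0 else v (i - j))"
    have "q \<in> fps_ideal j" by (simp add: q_def fps_ideal_def)
    then obtain x where x: "x \<in> layer u n j" "snd x = int n * v n" "cocycle u x - q \<in> fps_ideal (j + n)"
      using ex_layer[OF dvd_triv_left] by blast
    have "int p dvd fps_nth (cocycle u x - q) (j + i)" if "i < n" for i
      using x(3) that by (simp add: fps_ideal_def)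
    then show ?thesis
      using x(1,2) n by (intro bexI[of _ x]) (auto simp: less_Suc_eq q_def)
  qed
  show ?thesis
  proof (rule K.card_generators_ge[where \<psi> = ?\<psi>, OF p_gt_1])
    show "S \<subseteq> carrier (L\<lparr>carrier := layer u n j\<rparr>)"
      and "generate (L\<lparr>carrier := layer u n j\<rparr>) S = carrier (L\<lparr>carrier := layer u n j\<rparr>)"
      using S by simp_all
    show "\<exists>x\<in>carrier (L\<lparr>carrier := layer u n j\<rparr>). \<forall>i<Suc n. int p dvd ?\<psi> x i - v i" for v
      using onto[of v] by simp
    fix x y i
    assume "x \<in> carrier (L\<lparr>carrier := layer u n j\<rparr>)" "y \<in> carrier (L\<lparr>carrier := layer u n j\<rparr>)"
    then show "int p dvd ?\<psi> (x \<otimes>\<^bsub>L\<lparr>carrier := layer u n j\<rparr>\<^esub> y) i - (?\<psi> x i + ?\<psi> y i)"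
      using mult[of x y i] by (cases "i < n") simp_all
  qed (rule S(2))
qed

text \<open>The generators are one element of shift n and the lamps X^j t^b with 0 \<le> b < n.
  Conjugation by elements whose shift is a multiple of n yields X^j t^b for every b, hence all lamps
  in (X^j).\<close>

lemma ex_generators_layer:
  assumes n: "0 < n"
  shows "\<exists>S\<subseteq>layer u n j. finite S \<and> card S \<le> Suc n \<and>
    generate (L\<lparr>carrier := layer u n j\<rparr>) S = layer u n j"
proof -
  obtain y where y: "y \<in> layer u n j" "snd y = int n"
    using ex_layer[OF dvd_refl fps_ideal_0(2)] by blast
  let ?T = "(\<lambda>b. (shift b (diff_power j), 0 :: int)) ` {0..<int n}"
  let ?S = "insert y ?T"
  have lamp_in_layer: "(w, 0) \<in> layer u n j" if "w \<in> lamps" "lamp_series w \<in> fps_ideal j" for w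
    using that by (simp add: layer_def carrier_lamplighter cocycle_def)
  have S: "?S \<subseteq> layer u n j"
    using y by (auto intro!: lamp_in_layer shift_in_lamps diff_power_in_lamps
        simp: lamp_series_shift fps_ideal_mult_left diff_power_in_ideal)
  have card_S: "card ?S \<le> Suc n"
    using card_insert_le_m1[of "Suc n" ?T y] card_image_le[of "{0..<int n}" "\<lambda>b. (shift b (diff_power j), 0 :: int)"]
    by simp
  define K where "K = generate L ?S"
  have layer_sub: "layer u n j \<subseteq> carrier L"
    using subgroup_layer by (rule subgroup.subset)
  have "subgroup K L"
    unfolding K_def using S layer_sub by (intro lamplighter.generate_is_subgroup) blast
  then interpret K: subgroup K L .
  have S_K: "?S \<subseteq> K"
    unfolding K_def by (auto intro: generate.incl)
  have K_sub: "K \<subseteq> layer u n j"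
    unfolding K_def by (rule lamplighter.generate_subgroup_incl[OF S subgroup_layer])
  have ex_snd: "\<exists>z\<in>K. snd z = int n * k" for k
  proof (induction k rule: int_induct[where k = 0])
    case base
    then show ?case using K.one_closed by (auto simp: one_lamplighter intro!: bexI)
  next
    case (step1 k)
    then obtain z where "z \<in> K" "snd z = int n * k" by blast
    moreover have "y \<in> K" using S_K by simp
    ultimately have "z \<otimes>\<^bsub>L\<^esub> y \<in> K" "snd (z \<otimes>\<^bsub>L\<^esub> y) = int n * (k + 1)"
      using y by (simp, simp add: mult_lamplighter distrib_left)
    then show ?case by blast
  next
    case (step2 k)
    then obtain z where "z \<in> K" "snd z = int n * k" by blast
    moreover have "y \<in> K" using S_K by simp
    ultimately have "z \<otimes>\<^bsub>L\<^esub> inv\<^bsub>L\<^esub> y \<in> K" "snd (z \<otimes>\<^bsub>L\<^esub> inv\<^bsub>L\<^esub> y) = int n * (k - 1)"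
      using y K.mem_carrier
      by (simp, simp add: mult_lamplighter snd_inv_lamplighter right_diff_distrib)
    then show ?case by blast
  qed
  let ?N = "{w. w \<in> lamps \<and> (w, 0) \<in> K}"
  have lamp_in_K: "(w, 0) \<in> K" if w: "w \<in> lamps" "lamp_series w \<in> fps_ideal j" for w
  proof -
    have "w \<in> ?N"
    proof (rule ideal_generated_by_shifts[OF _ _ _ w])
      show "(\<lambda>_. 0) \<in> ?N"
        using K.one_closed by (simp add: one_lamplighter)
    next
      fix v w assume "v \<in> ?N" "w \<in> ?N"
      then show "add_lamps v w \<in> ?N"
        using K.m_closed[of "(v, 0)" "(w, 0)"]
        by (simp add: mult_lamplighter add_lamps_in_lamps shift_def)
    next
      fix b
      \<comment> \<open>The remainder of b modulo n picks a generator, the quotient a conjugating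
        element.\<close>
      let ?w = "shift (b mod int n) (diff_power j)"
      obtain z where z: "z \<in> K" "snd z = int n * (b div int n)"
        using ex_snd by blast
      have "(?w, 0) \<in> K"
        using S_K n by (auto intro!: subsetD[OF S_K])
      then have "z \<otimes>\<^bsub>L\<^esub> (?w, 0) \<otimes>\<^bsub>L\<^esub> inv\<^bsub>L\<^esub> z \<in> K"
        using z by simp
      then have "(shift b (diff_power j), 0) \<in> K"
        using z K.mem_carrier
        by (simp add: conjugate_lamp shift_in_lamps diff_power_in_lamps)
      then show "shift b (diff_power j) \<in> ?N"
        by (simp add: shift_in_lamps diff_power_in_lamps)
    qed
    then show ?thesis by simp
  qed
  have "layer u n j \<subseteq> K"
  proof
    fix x assume x: "x \<in> layer u n j"
    then obtain k where "snd x = int n * k"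
      by (auto simp: layer_def dvd_def)
    then obtain z where z: "z \<in> K" "snd z = snd x"
      using ex_snd by metis
    have zx: "z \<in> carrier L" "x \<in> carrier L" using z x by (auto simp: layer_def)
    \<comment> \<open>Dividing by an element of the same shift leaves a pure lamp, whose cocycle
      does not involve \<open>u\<close>.\<close>
    let ?r = "x \<otimes>\<^bsub>L\<^esub> inv\<^bsub>L\<^esub> z"
    have r: "?r \<in> layer u n j"
      using x z(1) K_sub subgroup.m_closed[OF subgroup_layer] subgroup.m_inv_closed[OF subgroup_layer]
      by blast
    have "snd ?r = 0"
      using z zx by (simp add: mult_lamplighter[of x] snd_inv_lamplighter)
    then obtain w where w: "?r = (w, 0)" by (cases ?r) auto
    with r have "(w, 0) \<in> K"
      by (intro lamp_in_K) (simp_all add: layer_def carrier_lamplighter cocycle_def)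
    then have "?r \<otimes>\<^bsub>L\<^esub> z \<in> K"
      using w z(1) by simp
    then show "x \<in> K"
      using zx by (simp add: lamplighter.m_assoc)
  qed
  then have "generate (L\<lparr>carrier := layer u n j\<rparr>) ?S = layer u n j"
    using lamplighter.generate_consistent[OF S subgroup_layer] K_sub K_def by simp
  then show ?thesis using S card_S by (intro exI[of _ ?S]) simp
qed

lemma min_gens_layer:
  assumes "0 < n" "tpow (int n) - 1 \<in> fps_ideal n"
  shows "min_gens (L\<lparr>carrier := layer u n j\<rparr>) = enat (Suc n)"
proof (rule antisym)
  obtain S where S: "S \<subseteq> layer u n j" "finite S" "card S \<le> Suc n"
    "generate (L\<lparr>carrier := layer u n j\<rparr>) S = layer u n j"
    using ex_generators_layer[OF assms(1)] by blast
  then have "min_gens (L\<lparr>carrier := layer u n j\<rparr>) \<le> enat (card S)"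
    unfolding min_gens_def by (intro INF_lower) simp
  also have "\<dots> \<le> enat (Suc n)" using S by simp
  finally show "min_gens (L\<lparr>carrier := layer u n j\<rparr>) \<le> enat (Suc n)" .
  show "enat (Suc n) \<le> min_gens (L\<lparr>carrier := layer u n j\<rparr>)"
    unfolding min_gens_def using card_generators_layer_ge[OF assms] by (intro INF_greatest) auto
qed

end

section \<open>A series that is not rational\<close>

text \<open>The gaps between the exponents outgrow every degree, so the series is irrational modulo
  every prime at once.\<close>

definition gap_series :: "int fps"
  where "gap_series = Abs_fps (\<lambda>m. if \<exists>e. m = 2 ^ e then 1 else 0)"

text \<open>Once the gaps exceed the degree of \<open>P\<close>, its leading coefficient reappears in the product
  after each of them.\<close>

lemma gap_series_mult_nth:
  assumes "\<And>m. D < m \<Longrightarrow> fps_nth P m = 0" and "D < 2 ^ e"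
  shows "fps_nth (gap_series * P) (2 ^ e + D) = fps_nth P D"
proof -
  have "fps_nth gap_series l * fps_nth P (2 ^ e + D - l) = 0"
    if l: "l \<le> 2 ^ e + D" "l \<noteq> 2 ^ e" for l
  proof (cases "l < 2 ^ e")
    case True
    then show ?thesis using assms(1)[of "2 ^ e + D - l"] by simp
  next
    case False
    \<comment> \<open>Such an l lies strictly between consecutive powers of two, as D < 2^e.\<close>
    have "l \<noteq> 2 ^ f" for f
    proof
      assume f: "l = 2 ^ f"
      have "(2 :: nat) ^ e < 2 ^ f" using False l f by simp
      moreover have "(2 :: nat) ^ f < 2 ^ Suc e" using l f assms(2) by simp
      ultimately have "e < f" "f < Suc e"
        by (simp_all only: power_strict_increasing_iff one_less_numeral_iff semiring_norm)
      then show False by simp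
    qed
    then show ?thesis by (simp add: gap_series_def)
  qed
  then have "fps_nth (gap_series * P) (2 ^ e + D)
      = (\<Sum>l\<in>{2 ^ e}. fps_nth gap_series l * fps_nth P (2 ^ e + D - l))"
    unfolding fps_mult_nth by (intro sum.mono_neutral_right) auto
  then show ?thesis by (auto simp: gap_series_def)
qed

text \<open>Nonnegative powers of t are polynomials in X; only negative exponents give infinite
  series.\<close>

lemma lamp_series_nth_eventually_0:
  assumes "{i. w i \<noteq> 0} \<subseteq> {0..<int d}" "d \<le> m"
  shows "fps_nth (lamp_series w) m = 0"
proof -
  have "fps_nth (tpow i) m = 0" if "i \<in> {0..<int d}" for i
    using that assms(2) by (auto simp: tpow_def fps_nth_one_plus_X_power binomial_eq_0)
  then show ?thesis
    by (subst lamp_series_eq_sum[OF _ assms(1)])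
      (simp_all add: fps_sum_nth flip: fps_of_int)
qed

context prime_modulus
begin

text \<open>For k \<noteq> 0 the series would be a quotient of polynomials modulo p. A power of t
  clears the negative exponents; t^k - 1 then has leading coefficient 1 or -1, which recurs in the
  product with \<open>gap_series\<close> in arbitrarily high degree.\<close>

lemma gap_series_irrational:
  assumes "finite {i. w i \<noteq> 0}"
    and ideal: "\<And>j. lamp_series w - gap_series * (tpow k - 1) \<in> fps_ideal j"
  shows "k = 0"
proof (rule ccontr)
  assume k: "k \<noteq> 0"
  obtain a d where supp: "{i. w i \<noteq> 0} \<subseteq> {a..<a + int d}"
    using finite_support_bounded[OF assms(1)] .
  \<comment> \<open>Large enough that a + b and k + b are both nonnegative.\<close>
  define b where "b = nat (\<bar>a\<bar> + \<bar>k\<bar>)"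
  define c where "c = nat (int b + k)"
  have bc: "int c = int b + k" "b \<noteq> c" "0 \<le> a + int b"
    using k by (auto simp: b_def c_def)
  define P :: "int fps" where "P = (1 + fps_X) ^ c - (1 + fps_X) ^ b"
  have "{i. shift (int b) w i \<noteq> 0} \<subseteq> {0..<int (nat (a + int b + int d))}"
    using supp bc(3) unfolding support_shift by force
  then have vanish: "fps_nth (lamp_series (shift (int b) w)) m = 0" if "nat (a + int b + int d) \<le> m" for m
    using lamp_series_nth_eventually_0 that by blast
  have P: "P = tpow (int b) * tpow k - tpow (int b)"
    unfolding P_def tpow_of_nat[symmetric] bc(1) tpow_add ..
  have "tpow (int b) * (lamp_series w - gap_series * (tpow k - 1))
      = lamp_series (shift (int b) w) - gap_series * P"
    unfolding P lamp_series_shift by (simp add: algebra_simps)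
  with ideal have shifted: "lamp_series (shift (int b) w) - gap_series * P \<in> fps_ideal j" for j
    using fps_ideal_mult_left by metis
  define D where "D = max b c"
  have P_0: "fps_nth P m = 0" if "D < m" for m
    using that by (simp add: P_def D_def fps_nth_one_plus_X_power binomial_eq_0)
  have P_D: "\<bar>fps_nth P D\<bar> = 1"
    using bc(2) by (auto simp: P_def D_def fps_nth_one_plus_X_power binomial_eq_0 max_def)
  \<comment> \<open>In degree 2^e + D the shifted lamps have no term left, and the gap around 2^e
    exceeds the degree of \<open>P\<close>.\<close>
  define e where "e = D + nat (a + int b + int d)"
  have e: "D \<le> e" "nat (a + int b + int d) \<le> e" "e < 2 ^ e"
    by (simp_all add: e_def)
  have "fps_nth (gap_series * P) (2 ^ e + D) = fps_nth P D"
    using e by (intro gap_series_mult_nth P_0) linarith+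
  moreover have "fps_nth (lamp_series (shift (int b) w)) (2 ^ e + D) = 0"
    using e by (intro vanish) linarith
  ultimately have "int p dvd - fps_nth P D"
    using shifted[of "Suc (2 ^ e + D)"] by (simp add: fps_ideal_Suc)
  then have "int p dvd 1"
    using P_D by (metis dvd_abs_iff dvd_minus_iff)
  then show False
    using p_gt_1 by simp
qed

text \<open>The cocycle vanishes to every order, so irrationality forces shift 0; then the cocycle
  is the lamp series itself, and the lamps are zero too.\<close>

lemma Inter_layers:
  assumes "\<And>j. \<exists>i. j \<le> J i"
  shows "(\<Inter>i. layer gap_series (n i) (J i)) = {\<one>\<^bsub>L\<^esub>}"
proof
  show "{\<one>\<^bsub>L\<^esub>} \<subseteq> (\<Inter>i. layer gap_series (n i) (J i))"
    by (simp add: subgroup.one_closed[OF subgroup_layer])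
  show "(\<Inter>i. layer gap_series (n i) (J i)) \<subseteq> {\<one>\<^bsub>L\<^esub>}"
  proof
    fix x assume x: "x \<in> (\<Inter>i. layer gap_series (n i) (J i))"
    have ideal: "cocycle gap_series x \<in> fps_ideal j" for j
    proof -
      obtain i where "j \<le> J i" using assms by blast
      moreover have "cocycle gap_series x \<in> fps_ideal (J i)"
        using x by (auto simp: layer_def)
      ultimately show ?thesis using fps_ideal_antimono by blast
    qed
    have w: "fst x \<in> lamps"
      using x by (auto simp: layer_def carrier_lamplighter)
    have k: "snd x = 0"
      using gap_series_irrational[OF finite_support[OF w]] ideal by (simp add: cocycle_def)
    have "fst x = (\<lambda>_. 0)"
      using lamps_eq_zero[OF w] ideal k by (simp add: cocycle_def)
    with k show "x \<in> {\<one>\<^bsub>L\<^esub>}"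
      by (simp add: one_lamplighter prod_eq_iff)
  qed
qed

end

section \<open>The chain belonging to g\<close>

theorem theorem4p2:
  fixes p :: nat and g :: "nat \<Rightarrow> nat"
  assumes "Factorial_Ring.prime p"
    and "g 0 = 2"
    and "\<And>i. g (Suc i) = g i \<or> int (g (Suc i)) = int p * int (g i) - int p + 1"
    and "infinite {i. g i = g (Suc i)}"
  shows "\<exists>H :: nat \<Rightarrow> ((int \<Rightarrow> int) \<times> int) set.
    p_chain p (lamplighter_group p) H \<and>
    subnormal_chain (lamplighter_group p) H \<and>
    H 0 = carrier (lamplighter_group p) \<and>
    (\<forall>i. min_gens ((lamplighter_group p)\<lparr>carrier := H i\<rparr>) = enat (g i)) \<and>
    (\<Inter>i. H i) = {\<one>\<^bsub>lamplighter_group p\<^esub>}"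
proof -
  interpret prime_modulus p by unfold_locales (rule assms(1))
  define n where "n i = g i - 1" for i
  \<comment> \<open>Counts the stationary steps before i, so that the chain starts with n = 1 and j
    = 0.\<close>
  define J where "J i = card {l \<in> {..<i}. g l = g (Suc l)}" for i
  define H where "H i = layer gap_series (n i) (J i)" for i
  \<comment> \<open>A prime power is what makes t^n - 1 divisible by X^n modulo p; the second
    conjunct undoes the truncated subtraction in \<open>n\<close>.\<close>
  have n_pow: "\<exists>a. n i = p ^ a \<and> g i = Suc (n i)" for i
  proof (induction i)
    case 0
    then show ?case using assms(2) by (auto simp: n_def intro: exI[of _ 0])
  next
    case (Suc i)
    then obtain a where a: "n i = p ^ a" "g i = Suc (n i)" by blast
    show ?case
    proof (cases "g (Suc i) = g i")
      case True
      then have "n (Suc i) = n i" by (simp add: n_def)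
      then show ?thesis using a True by auto
    next
      case False
      \<comment> \<open>Rewrites p g(i) - p + 1 as p (g(i) - 1) + 1.\<close>
      then have "int (g (Suc i)) = int (Suc (p * n i))"
        using assms(3)[of i] a(2) by (simp add: distrib_left)
      then have "g (Suc i) = Suc (p * n i)" by (simp only: of_nat_eq_iff)
      moreover from this have "n (Suc i) = p * n i" by (simp add: n_def)
      ultimately have "n (Suc i) = p ^ Suc a \<and> g (Suc i) = Suc (n (Suc i))"
        using a(1) by simp
      then show ?thesis by blast
    qed
  qed
  have n_pos: "0 < n i" for i
    using n_pow[of i] p_pos by auto
  have J_Suc: "J (Suc i) = (if g i = g (Suc i) then Suc (J i) else J i)" for i
  proof -
    have "{l \<in> {..<Suc i}. g l = g (Suc l)} =
        (if g i = g (Suc i) then insert i {l \<in> {..<i}. g l = g (Suc l)}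
         else {l \<in> {..<i}. g l = g (Suc l)})"
      by (auto simp: less_Suc_eq)
    then show ?thesis by (simp add: J_def)
  qed
  have step: "H (Suc i) \<lhd> L\<lparr>carrier := H i\<rparr> \<and> subgroup_index (L\<lparr>carrier := H i\<rparr>) (H (Suc i)) = p" for i
  proof (cases "g i = g (Suc i)")
    case True
    then have "n (Suc i) = n i" "J (Suc i) = Suc (J i)"
      by (simp_all add: n_def J_Suc)
    then show ?thesis by (simp add: H_def layer_Suc)
  next
    case False
    then have "int (g (Suc i)) = int (Suc (p * n i))"
      using assms(3)[of i] n_pow[of i] by (auto simp: distrib_left)
    then have "g (Suc i) = Suc (p * n i)" by (simp only: of_nat_eq_iff)
    then have "n (Suc i) = p * n i" "J (Suc i) = J i"
      using False by (simp_all add: n_def J_Suc)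
    then show ?thesis by (simp add: H_def layer_mult n_pos)
  qed
  have chain: "descending_chain L H"
    unfolding descending_chain_def
  proof (intro conjI allI)
    show "subgroup (H i) L" for i by (simp add: H_def subgroup_layer)
    show "H (Suc i) \<subseteq> H i" for i
      using step[of i] subgroup.subset[OF normal_imp_subgroup] by fastforce
  qed
  have unbounded: "\<exists>i. j \<le> J i" for j
  proof (induction j)
    case (Suc j)
    then obtain i where "j \<le> J i" by blast
    \<comment> \<open>A stationary step at or after i exists by infinitude and raises
      \<open>J\<close> by one.\<close>
    obtain l where l: "i \<le> l" "g l = g (Suc l)"
      using assms(4) by (auto simp: infinite_nat_iff_unbounded_le)
    have "J i \<le> J l" unfolding J_def using l(1) by (intro card_mono) auto
    then have "Suc j \<le> J (Suc l)" using l(2) \<open>j \<le> J i\<close> by (simp add: J_Suc)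
    then show ?case by blast
  qed simp
  have gens: "min_gens (L\<lparr>carrier := H i\<rparr>) = enat (g i)" for i
  proof -
    obtain a where a: "n i = p ^ a" "g i = Suc (n i)" using n_pow by blast
    have "tpow (int (n i)) - 1 \<in> fps_ideal (n i)"
      unfolding a(1) by (rule tpow_prime_power)
    then show ?thesis
      unfolding H_def a(2) by (intro min_gens_layer n_pos)
  qed
  have H_0: "H 0 = carrier L"
    using assms(2) layer_0 by (simp add: H_def n_def J_def)
  show ?thesis
    using chain step gens H_0 Inter_layers[OF unbounded, of n]
    by (intro exI[of _ H]) (simp add: p_chain_def subnormal_chain_def H_def)
qed

end
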